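(* Let $ABC$ be a triangle in the Euclidean plane with circumcircle $\Sigma$ and orthocentre $H$, and let $J$ be a point of $\Sigma$ distinct from $A,B,C$. Let $Q$ be any point on the perpendicular bisector of $JH$, and let $S$ be the circle with centre $Q$ passing through $J$ and $H$. Let $X, Y, Z$ be the second intersections (other than $H$) with $S$ of the altitudes of $ABC$ through $A$, $B$, $C$ respectively. Assume that each of the triples $A,J,X$; $B,J,Y$; $C,J,Z$ consists of three distinct non-collinear points, so that the circles $AJX$, $BJY$, $CJZ$ are defined. Let $L$ be the second intersection (other than $J$) of circles $BJY$ and $CJZ$, let $M$ be the second intersection of circles $CJZ$ and $AJX$, and let $N$ be the second intersection of circles $AJX$ and $BJY$. Let $A_0, B_0, C_0$ be the images of $A, B, C$ under the direct similarity of the plane that fixes $J$ and maps $H$ to $Q$. Then $L$, $M$, $N$ are the reflections of $J$ in the lines $B_0C_0$, $C_0A_0$, $A_0B_0$ respectively, so that the line $LMN$ is the Double Wallace-Simson line of $J$ with respect to triangle $A_0B_0C_0$; and the point $Q$ lies on the line $LMN$.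
   Context: The altitude through $A$ is the line through $A$ perpendicular to $BC$, and similarly for $B$ and $C$. Each altitude passes through $H$, which lies on $S$; if an altitude is tangent to $S$ at $H$, the corresponding second intersection is taken to be $H$ itself. Similarly, if two of the circles $AJX$, $BJY$, $CJZ$ were tangent at $J$, their second intersection would be taken to be $J$. A direct similarity is an orientation-preserving similarity; since $J\neq H$, there is a unique direct similarity fixing $J$ and mapping $H$ to $Q$ (a rotation about $J$ combined with a dilation centred at $J$). For a triangle $T$ and a point $P$ on its circumcircle, the reflections of $P$ in the three side lines of $T$ are collinear, and the line containing them is called the Double Wallace-Simson line of $P$ with respect to $T$. *)

theory Defs
  imports "HOL-Analysis.Analysis"
begin

text \<open>
  The Euclidean plane is the type \<^typ>\<open>complex\<close>, with its distance, inner product and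
  affine structure as a real inner product space.
\<close>

definition line_through :: "complex \<Rightarrow> complex \<Rightarrow> complex set" where
  "line_through P R = affine hull {P, R}"

definition is_circle :: "complex set \<Rightarrow> bool" where
  "is_circle k \<longleftrightarrow> (\<exists>c r. r > 0 \<and> k = sphere c r)"

text \<open>Only meaningful for non-collinear \<open>A\<close>, \<open>B\<close>, \<open>C\<close>; then the circle is unique.\<close>

definition circumcircle :: "complex \<Rightarrow> complex \<Rightarrow> complex \<Rightarrow> complex set" where
  "circumcircle A B C = (THE k. is_circle k \<and> A \<in> k \<and> B \<in> k \<and> C \<in> k)"

text \<open>The altitude through the first argument, as a full line (also when the angle there is right).\<close>

definition altitude :: "complex \<Rightarrow> complex \<Rightarrow> complex \<Rightarrow> complex set" where
  "altitude A B C = {P. orthogonal (P - A) (C - B)}"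

definition orthocentre :: "complex \<Rightarrow> complex \<Rightarrow> complex \<Rightarrow> complex" where
  "orthocentre A B C = (THE H. H \<in> altitude A B C \<and> H \<in> altitude B C A \<and> H \<in> altitude C A B)"

definition perpendicular_bisector :: "complex \<Rightarrow> complex \<Rightarrow> complex set" where
  "perpendicular_bisector P R = {T. orthogonal (T - midpoint P R) (R - P)}"

text \<open>
  \<open>R\<close> is the second intersection, other than \<open>P\<close>, of a circle with a line or with another circle.
  In the tangent case \<open>k \<inter> l = {P}\<close> this forces \<open>R = P\<close>, and otherwise it forces \<open>R \<noteq> P\<close>.
\<close>

definition second_intersection :: "complex set \<Rightarrow> complex set \<Rightarrow> complex \<Rightarrow> complex \<Rightarrow> bool" where
  "second_intersection k l P R \<longleftrightarrow> k \<inter> l = {P, R}"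

text \<open>
  For a line \<open>l\<close>, the point of \<open>l\<close> closest to \<open>P\<close> is the foot of the perpendicular from \<open>P\<close>,
  and it is the midpoint of \<open>P\<close> and its reflection.
\<close>

definition reflection_in :: "complex set \<Rightarrow> complex \<Rightarrow> complex" where
  "reflection_in l P = 2 * closest_point l P - P"

definition similarity :: "(complex \<Rightarrow> complex) \<Rightarrow> bool" where
  "similarity f \<longleftrightarrow> (\<exists>k>0. \<forall>z w. dist (f z) (f w) = k * dist z w)"

text \<open>
  Twice the signed area of the triangle \<open>u v w\<close>, i.e. the determinant of the vectors
  \<open>v - u\<close>, \<open>w - u\<close>; it is positive iff the triangle is non-degenerate and counterclockwise.
\<close>

definition signed_area2 :: "complex \<Rightarrow> complex \<Rightarrow> complex \<Rightarrow> real" where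
  "signed_area2 u v w = Re (v - u) * Im (w - u) - Im (v - u) * Re (w - u)"

definition orientation_preserving :: "(complex \<Rightarrow> complex) \<Rightarrow> bool" where
  "orientation_preserving f \<longleftrightarrow>
     (\<forall>u v w. signed_area2 u v w > 0 \<longrightarrow> signed_area2 (f u) (f v) (f w) > 0)"

definition direct_similarity :: "(complex \<Rightarrow> complex) \<Rightarrow> bool" where
  "direct_similarity f \<longleftrightarrow> similarity f \<and> orientation_preserving f"

text \<open>
  The three reflections of a point never all coincide for a non-degenerate triangle, so if they lie on a line
  then that line is their affine hull.
\<close>

definition double_wallace_simson_line ::
    "complex \<Rightarrow> complex \<Rightarrow> complex \<Rightarrow> complex \<Rightarrow> complex set" where
  "double_wallace_simson_line A B C P =
     affine hull {reflection_in (line_through B C) P,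
                  reflection_in (line_through C A) P,
                  reflection_in (line_through A B) P}"

end

theory Submission
  imports Defs
begin

text \<open>
  A direct similarity of the complex plane has the form \<open>f z = J + k * (z - J)\<close> once it fixes
  \<open>J\<close>. The point \<open>H\<close> is not \<open>J\<close>, since an orthocentre lying on the circumcircle is a vertex
  (\<open>orthocentre_on_circumcircle_is_vertex\<close>); so the condition that \<open>Q = f H\<close> is equidistant from
  \<open>J\<close> and \<open>H\<close> says exactly that \<open>k\<close> has real part one half. Consequently \<open>f z\<close> is equidistant
  from \<open>J\<close> and \<open>z\<close> for every \<open>z\<close>: all the triangles with vertices \<open>J\<close>, \<open>z\<close>, \<open>f z\<close> are similar
  and isosceles.

  The heart of the matter is that \<open>f A\<close> is the centre of the circle \<open>A J X\<close>
  (\<open>circumcircle_vertex_second_intersection\<close>). It remains to see that \<open>f A\<close> is equidistant from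
  \<open>A\<close> and \<open>X\<close>. Now \<open>Q\<close> projects orthogonally to the midpoint of the chord \<open>H X\<close> of the altitude, and
  \<open>f A\<close> is \<open>Q + k * (A - H)\<close>; as \<open>Re k = 1 / 2\<close>, its projection is moved by \<open>(A - H) / 2\<close>, which
  takes the midpoint of \<open>H X\<close> to the midpoint of \<open>A X\<close>.

  So the three circles pass through \<open>J\<close> and have the vertices of the image triangle as centres.
  Two circles meet again in the reflection of a common point in their line of centres
  (\<open>second_intersection_circles_reflection\<close>), which makes \<open>L\<close>, \<open>M\<close>, \<open>N\<close> the three reflections of \<open>J\<close>.
  The image triangle has orthocentre \<open>f H = Q\<close> and \<open>J = f J\<close> lies on its circumcircle, so Steiner's
  theorem (\<open>steiner_theorem\<close>: the reflections of a point of the circumcircle in the sides are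
  collinear with the orthocentre) finishes the proof.
\<close>

section \<open>Collinearity and perpendicularity\<close>

lemma collinear_iff_signed_area2: "collinear {u, v, w} \<longleftrightarrow> signed_area2 u v w = 0"
proof -
  have "collinear {u, v, w} \<longleftrightarrow> collinear {v, u, w}"
    by (simp add: insert_commute)
  also have "\<dots> \<longleftrightarrow> collinear {0, v - u, w - u}"
    by (rule collinear_3) (simp add: NO_MATCH_def)
  also have "\<dots> \<longleftrightarrow> (w - u) / (v - u) \<in> \<real>"
    by (rule collinear_iff_Reals)
  also have "\<dots> \<longleftrightarrow> signed_area2 u v w = 0"
  proof (cases "v = u")
    case False
    then have "(Re (v - u))\<^sup>2 + (Im (v - u))\<^sup>2 \<noteq> 0"
      by (metis complex_neq_0 less_irrefl right_minus_eq)
    then show ?thesis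
      by (auto simp: complex_is_Real_iff Im_divide signed_area2_def algebra_simps)
  qed (simp add: signed_area2_def)
  finally show ?thesis .
qed

lemma inner_two_directions_unique:
  fixes x p q :: complex
  assumes "x \<bullet> p = 0" "x \<bullet> q = 0" and det: "Re p * Im q - Im p * Re q \<noteq> 0"
  shows "x = 0"
proof -
  have 1: "Re x * Re p + Im x * Im p = 0" and 2: "Re x * Re q + Im x * Im q = 0"
    using assms by (simp_all add: inner_complex_def)
  have "Re x * (Re p * Im q - Im p * Re q)
      = (Re x * Re p + Im x * Im p) * Im q - (Re x * Re q + Im x * Im q) * Im p"
    by (simp add: algebra_simps)
  then have "Re x = 0"
    using det by (simp only: 1 2 mult_zero_left diff_self mult_eq_0_iff) simp
  have "Im x * (Re p * Im q - Im p * Re q)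
      = (Re x * Re q + Im x * Im q) * Re p - (Re x * Re p + Im x * Im p) * Re q"
    by (simp add: algebra_simps)
  then have "Im x = 0"
    using det by (simp only: 1 2 mult_zero_left diff_self mult_eq_0_iff) simp
  then show ?thesis
    using \<open>Re x = 0\<close> by (simp add: complex_eq_iff)
qed

lemma inner_two_directions_exists:
  fixes p q :: complex
  assumes det: "Re p * Im q - Im p * Re q \<noteq> 0"
  obtains x :: complex where "x \<bullet> p = s" "x \<bullet> q = t"
proof -
  define D where "D = Re p * Im q - Im p * Re q"
  define x where "x = Complex ((s * Im q - t * Im p) / D) ((t * Re p - s * Re q) / D)"
  have "x \<bullet> p = ((s * Im q - t * Im p) * Re p + (t * Re p - s * Re q) * Im p) / D"
    by (simp add: x_def inner_complex_def add_divide_distrib)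
  also have "(s * Im q - t * Im p) * Re p + (t * Re p - s * Re q) * Im p = s * D"
    by (simp add: D_def algebra_simps)
  finally have 1: "x \<bullet> p = s"
    using det by (simp add: D_def)
  have "x \<bullet> q = ((s * Im q - t * Im p) * Re q + (t * Re p - s * Re q) * Im q) / D"
    by (simp add: x_def inner_complex_def add_divide_distrib)
  also have "(s * Im q - t * Im p) * Re q + (t * Re p - s * Re q) * Im q = t * D"
    by (simp add: D_def algebra_simps)
  finally have 2: "x \<bullet> q = t"
    using det by (simp add: D_def)
  show thesis
    using 1 2 by (rule that)
qed

lemma common_perpendicular_parallel:
  fixes x y d :: complex
  assumes "x \<bullet> d = 0" "y \<bullet> d = 0" "d \<noteq> 0" "y \<noteq> 0"
  obtains s where "x = s *\<^sub>R y"
proof -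
  have "Re x * Re d + Im x * Im d = 0" "Re y * Re d + Im y * Im d = 0"
    using assms by (simp_all add: inner_complex_def)
  then have "(Re y * Im x - Im y * Re x) * Re d = 0" "(Re y * Im x - Im y * Re x) * Im d = 0"
    by algebra+
  then have "Re y * Im x - Im y * Re x = 0"
    using \<open>d \<noteq> 0\<close> by (auto simp: complex_eq_iff)
  then have "collinear {0, y, x}"
    by (simp add: collinear_iff_signed_area2 signed_area2_def)
  then show thesis
    using that \<open>y \<noteq> 0\<close> by (metis collinear_lemma scaleR_zero_left)
qed

lemma inner_mult_self: "z \<bullet> (w * z) = Re w * (z \<bullet> z)" for z w :: complex
  by (simp add: inner_complex_def algebra_simps)

text \<open>
  Equidistance of \<open>U\<close> from \<open>P\<close> and \<open>R\<close> as a bilinear condition: the vector from \<open>U\<close> to the midpoint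
  of the chord is perpendicular to the chord. In this form it also covers the tangent case \<open>P = R\<close>,
  and a factor of the chord vector can be cancelled.
\<close>

lemma dist_eq_iff_chord:
  fixes P R U :: complex
  shows "dist U R = dist U P \<longleftrightarrow> (R - P) \<bullet> (R + P - 2 * U) = 0"
proof -
  have "dist U R = dist U P \<longleftrightarrow> (dist U R)\<^sup>2 = (dist U P)\<^sup>2"
    by (metis power2_eq_iff_nonneg zero_le_dist)
  also have "\<dots> \<longleftrightarrow> (R - P) \<bullet> (R + P - 2 * U) = 0"
    unfolding dist_norm cmod_power2
    by (auto simp: inner_complex_def power2_eq_square algebra_simps)
  finally show ?thesis .
qed

section \<open>Circumcircle and orthocentre\<close>

lemma equidistant_points_eq:
  fixes A B C c c' :: complex
  assumes "\<not> collinear {A, B, C}"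
    and "dist c B = dist c A" "dist c C = dist c A"
    and "dist c' B = dist c' A" "dist c' C = dist c' A"
  shows "c = c'"
proof -
  have chord: "(B - A) \<bullet> (B + A - 2 * c) = 0" "(C - A) \<bullet> (C + A - 2 * c) = 0"
    "(B - A) \<bullet> (B + A - 2 * c') = 0" "(C - A) \<bullet> (C + A - 2 * c') = 0"
    using assms(2-5) by (simp_all add: dist_eq_iff_chord)
  have "(c - c') \<bullet> (D - A) = ((D - A) \<bullet> (D + A - 2 * c') - (D - A) \<bullet> (D + A - 2 * c)) / 2" for D
    by (simp add: inner_complex_def algebra_simps)
  then have "(c - c') \<bullet> (B - A) = 0" "(c - c') \<bullet> (C - A) = 0"
    by (simp_all only: chord diff_self div_0)
  moreover have "Re (B - A) * Im (C - A) - Im (B - A) * Re (C - A) \<noteq> 0"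
    using assms(1) by (simp add: collinear_iff_signed_area2 signed_area2_def)
  ultimately have "c - c' = 0"
    by (rule inner_two_directions_unique)
  then show ?thesis by simp
qed

text \<open>
  Reduces the definite description of a circumcircle to exhibiting an equidistant point.
\<close>

lemma circumcircle_eqI:
  assumes "\<not> collinear {A, B, C}" and "dist c A = r" "dist c B = r" "dist c C = r"
  shows "circumcircle A B C = sphere c r"
  unfolding circumcircle_def
proof (rule the_equality)
  have "A \<noteq> B" using assms(1) by auto
  then have "r > 0"
    using assms(2,3) by (metis dist_eq_0_iff zero_less_dist_iff)
  then show "is_circle (sphere c r) \<and> A \<in> sphere c r \<and> B \<in> sphere c r \<and> C \<in> sphere c r"
    using assms(2-4) by (auto simp: is_circle_def)
next
  fix k assume "is_circle k \<and> A \<in> k \<and> B \<in> k \<and> C \<in> k"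
  then obtain c' r' where k: "k = sphere c' r'" "dist c' A = r'" "dist c' B = r'" "dist c' C = r'"
    by (auto simp: is_circle_def)
  then have "c' = c"
    using assms by (intro equidistant_points_eq[of A B C]) auto
  then show "k = sphere c r"
    using k assms by simp
qed

lemma circumcentre_exists:
  fixes A B C :: complex
  assumes "\<not> collinear {A, B, C}"
  obtains c r where "r > 0" "dist c A = r" "dist c B = r" "dist c C = r"
proof -
  have "Re (B - A) * Im (C - A) - Im (B - A) * Re (C - A) \<noteq> 0"
    using assms by (simp add: collinear_iff_signed_area2 signed_area2_def)
  then obtain x where x: "x \<bullet> (B - A) = (B - A) \<bullet> (B - A) / 2" "x \<bullet> (C - A) = (C - A) \<bullet> (C - A) / 2"
    by (rule inner_two_directions_exists)
  have "(B - A) \<bullet> (B + A - 2 * (A + x)) = 0" "(C - A) \<bullet> (C + A - 2 * (A + x)) = 0"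
    using x by (simp_all add: inner_complex_def algebra_simps)
  then have d: "dist (A + x) B = dist (A + x) A" "dist (A + x) C = dist (A + x) A"
    by (simp_all only: dist_eq_iff_chord)
  moreover have "A \<noteq> B" using assms by auto
  then have "dist (A + x) A > 0"
    using d(1) by (metis dist_eq_0_iff zero_less_dist_iff)
  ultimately show thesis
    using that by blast
qed

text \<open>
  With the circumcentre \<open>c\<close> as origin the orthocentre is the sum of the vertices: the vector from
  \<open>A\<close> to it is \<open>(B - c) + (C - c)\<close>, twice the vector from \<open>c\<close> to the midpoint of the chord \<open>B C\<close>.
\<close>

lemma orthocentre_eq:
  assumes "\<not> collinear {A, B, C}" and "dist c A = r" "dist c B = r" "dist c C = r"
  shows "orthocentre A B C = A + B + C - 2 * c"
  unfolding orthocentre_def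
proof (rule the_equality)
  have "dist c B = dist c A" "dist c C = dist c B" "dist c A = dist c C"
    using assms by simp_all
  then show "A + B + C - 2 * c \<in> altitude A B C \<and> A + B + C - 2 * c \<in> altitude B C A
      \<and> A + B + C - 2 * c \<in> altitude C A B"
    unfolding dist_eq_iff_chord
    by (simp add: altitude_def orthogonal_def inner_complex_def algebra_simps)
next
  fix H assume "H \<in> altitude A B C \<and> H \<in> altitude B C A \<and> H \<in> altitude C A B"
  then have alt: "(H - B) \<bullet> (A - C) = 0" "(H - C) \<bullet> (B - A) = 0"
    by (simp_all add: altitude_def orthogonal_def)
  have "dist c C = dist c A" "dist c B = dist c A"
    using assms by simp_all
  then have chord: "(C - A) \<bullet> (C + A - 2 * c) = 0" "(B - A) \<bullet> (B + A - 2 * c) = 0"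
    by (simp_all only: dist_eq_iff_chord)
  have "(H - (A + B + C - 2 * c)) \<bullet> (B - A) = (H - C) \<bullet> (B - A) - (B - A) \<bullet> (B + A - 2 * c)"
    "(H - (A + B + C - 2 * c)) \<bullet> (C - A) = - ((H - B) \<bullet> (A - C)) - (C - A) \<bullet> (C + A - 2 * c)"
    by (simp_all add: inner_complex_def algebra_simps)
  then have "(H - (A + B + C - 2 * c)) \<bullet> (B - A) = 0" "(H - (A + B + C - 2 * c)) \<bullet> (C - A) = 0"
    by (simp_all only: alt chord)
  moreover have "Re (B - A) * Im (C - A) - Im (B - A) * Re (C - A) \<noteq> 0"
    using assms(1) by (simp add: collinear_iff_signed_area2 signed_area2_def)
  ultimately have "H - (A + B + C - 2 * c) = 0"
    by (rule inner_two_directions_unique)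
  then show "H = A + B + C - 2 * c" by simp
qed

section \<open>Direct similarities\<close>

text \<open>
  After dividing by \<open>k = f 1 - f 0\<close> the map becomes an isometry fixing \<open>0\<close> and \<open>1\<close>. Distances to
  these two points determine a number up to conjugation; preservation of orientation forces \<open>\<i>\<close> to
  be fixed, and the distance to \<open>\<i>\<close> then settles the sign of every imaginary part.
\<close>

lemma direct_similarity_affine:
  assumes "direct_similarity f"
  obtains k where "k \<noteq> 0" "\<And>z w. f z - f w = k * (z - w)"
proof -
  obtain \<kappa> where \<kappa>: "\<kappa> > 0" "\<And>z w. dist (f z) (f w) = \<kappa> * dist z w"
    using assms by (auto simp: direct_similarity_def similarity_def)
  define k where "k = f 1 - f 0"
  define g where "g z = (f z - f 0) / k" for z
  have nk: "norm k = \<kappa>"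
    using \<kappa>(2)[of 1 0] by (simp add: k_def dist_norm)
  then have k0: "k \<noteq> 0" using \<kappa>(1) by auto
  have fg: "f z = f 0 + k * g z" for z
    using k0 by (simp add: g_def)
  have g01: "g 0 = 0" "g 1 = 1"
    using k0 by (simp_all add: g_def k_def)
  have iso: "dist (g z) (g w) = dist z w" for z w
  proof -
    have "g z - g w = (f z - f w) / k"
      by (simp add: g_def diff_divide_distrib)
    then show ?thesis
      using \<kappa> nk by (simp add: dist_norm norm_divide)
  qed
  have Re_g: "Re (g z) = Re z" and norm_g: "(Re (g z))\<^sup>2 + (Im (g z))\<^sup>2 = (Re z)\<^sup>2 + (Im z)\<^sup>2" for z
  proof -
    have "(dist (g z) (g 0))\<^sup>2 = (dist z 0)\<^sup>2" "(dist (g z) (g 1))\<^sup>2 = (dist z 1)\<^sup>2"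
      by (simp_all only: iso)
    then have a: "(Re (g z))\<^sup>2 + (Im (g z))\<^sup>2 = (Re z)\<^sup>2 + (Im z)\<^sup>2"
      "(Re (g z) - 1)\<^sup>2 + (Im (g z))\<^sup>2 = (Re z - 1)\<^sup>2 + (Im z)\<^sup>2"
      by (simp_all add: g01 dist_norm cmod_power2)
    then show "Re (g z) = Re z"
      by (simp add: power2_diff)
    show "(Re (g z))\<^sup>2 + (Im (g z))\<^sup>2 = (Re z)\<^sup>2 + (Im z)\<^sup>2"
      by (fact a)
  qed
  have "signed_area2 (f 0) (f 1) (f \<i>) > 0"
    using assms by (auto simp: direct_similarity_def orientation_preserving_def signed_area2_def)
  also have "signed_area2 (f 0) (f 1) (f \<i>) = (norm k)\<^sup>2 * Im (g \<i>)"
    unfolding fg[of 1] fg[of \<i>] g01 cmod_power2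
    by (simp add: signed_area2_def power2_eq_square algebra_simps)
  finally have "Im (g \<i>) > 0"
    by (simp add: zero_less_mult_iff)
  then have gi: "g \<i> = \<i>"
    using Re_g[of \<i>] norm_g[of \<i>] by (simp add: complex_eq_iff power2_eq_1_iff)
  have "g z = z" for z
  proof -
    have "(dist (g z) (g \<i>))\<^sup>2 = (dist z \<i>)\<^sup>2"
      by (simp only: iso)
    then have "(Re (g z))\<^sup>2 + (Im (g z) - 1)\<^sup>2 = (Re z)\<^sup>2 + (Im z - 1)\<^sup>2"
      by (simp add: gi dist_norm cmod_power2)
    then have "Im (g z) = Im z"
      using norm_g[of z] by (simp add: power2_diff)
    then show ?thesis
      using Re_g by (simp add: complex_eq_iff)
  qed
  then have "f z - f w = k * (z - w)" for z w
    using fg[of z] fg[of w] by (simp add: algebra_simps)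
  then show thesis
    using k0 that by blast
qed

lemma signed_area2_similarity:
  assumes "\<And>z w. f z - f w = k * (z - w)"
  shows "signed_area2 (f u) (f v) (f w) = (norm k)\<^sup>2 * signed_area2 u v w"
  unfolding signed_area2_def assms cmod_power2
  by (simp add: power2_eq_square algebra_simps)

section \<open>Reflections in a line\<close>

lemma in_line_iff:
  fixes P R :: complex
  shows "x \<in> affine hull {P, R} \<longleftrightarrow> (\<exists>t. x = P + t *\<^sub>R (R - P))"
  by (auto simp: affine_hull_2_alt)

text \<open>
  By Pythagoras, a point of the line at which the perpendicular from \<open>P\<close> meets it is the closest one.
\<close>

lemma reflection_in_eqI:
  assumes "(P + R) / 2 \<in> line_through U V" and "(R - P) \<bullet> (V - U) = 0"
  shows "reflection_in (line_through U V) P = R"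
proof -
  define m where "m = (P + R) / 2"
  obtain t where t: "m = U + t *\<^sub>R (V - U)"
    using assms(1) by (auto simp: line_through_def m_def in_line_iff)
  have "(m - P) \<bullet> (V - U) = 0"
    using assms(2) by (simp add: m_def inner_complex_def field_simps)
  then have perp: "orthogonal (m - P) (s *\<^sub>R (V - U))" for s
    by (simp add: orthogonal_def)
  have "dist P m \<le> dist P z" if z: "z \<in> line_through U V" for z
  proof -
    obtain s where s: "z = U + s *\<^sub>R (V - U)"
      using z by (auto simp: line_through_def in_line_iff)
    have "z - P = (m - P) + (s - t) *\<^sub>R (V - U)"
      by (simp add: s t algebra_simps)
    then have "(norm (z - P))\<^sup>2 = (norm (m - P))\<^sup>2 + (norm ((s - t) *\<^sub>R (V - U)))\<^sup>2"
      by (simp only: norm_add_Pythagorean[OF perp])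
    then have "(norm (m - P))\<^sup>2 \<le> (norm (z - P))\<^sup>2" by simp
    then have "norm (m - P) \<le> norm (z - P)"
      by (rule power2_le_imp_le) simp
    then show ?thesis
      by (simp add: dist_norm norm_minus_commute)
  qed
  then have "m = closest_point (line_through U V) P"
    using assms(1) by (intro closest_point_unique)
      (auto simp: m_def line_through_def affine_imp_convex closed_affine_hull)
  then have "reflection_in (line_through U V) P = 2 * m - P"
    by (simp add: reflection_in_def)
  also have "\<dots> = R"
    by (simp add: m_def field_simps)
  finally show ?thesis .
qed

text \<open>
  Reflection in the line of centres preserves both circles, so the reflection of \<open>J\<close> is one of the
  two common points. If it is \<open>J\<close> itself, then \<open>J\<close> lies on the line of centres and the circles are
  tangent there, so that \<open>L\<close> is \<open>J\<close> as well.
\<close>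

lemma second_intersection_circles_reflection:
  assumes UV: "U \<noteq> V"
    and L: "second_intersection (sphere U (dist U J)) (sphere V (dist V J)) J L"
  shows "L = reflection_in (line_through U V) J"
proof -
  define d where "d = V - U"
  \<comment> \<open>\<open>m\<close> is the foot of the perpendicular from \<open>J\<close> to the line of centres.\<close>
  define s where "s = (J - U) \<bullet> d / (d \<bullet> d)"
  define m where "m = U + s *\<^sub>R d"
  define R where "R = 2 * m - J"
  have dd: "d \<bullet> d \<noteq> 0" using UV by (simp add: d_def)
  have md: "(m - J) \<bullet> d = 0"
    using dd by (simp add: m_def s_def inner_diff_left inner_add_left)
  have RJ: "R - J = 2 *\<^sub>R (m - J)"
    by (simp add: R_def scaleR_conv_of_real)
  then have "(R - J) \<bullet> (V - U) = 0"
    using md by (simp add: d_def)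
  moreover have "(J + R) / 2 \<in> line_through U V"
    unfolding line_through_def in_line_iff by (rule exI[of _ s]) (simp add: R_def m_def d_def)
  ultimately have refl: "reflection_in (line_through U V) J = R"
    by (intro reflection_in_eqI)
  have "R + J - 2 * U = (2 * s) *\<^sub>R d" "R + J - 2 * V = (2 * s - 2) *\<^sub>R d"
    by (simp_all add: R_def m_def d_def scaleR_conv_of_real algebra_simps)
  then have "dist U R = dist U J" "dist V R = dist V J"
    unfolding dist_eq_iff_chord using RJ md by simp_all
  then have "R \<in> sphere U (dist U J) \<inter> sphere V (dist V J)" by simp
  then have "R \<in> {J, L}"
    using L by (simp only: second_intersection_def)
  moreover have "L = J" if "R = J"
  proof -
    have "L \<in> sphere U (dist U J) \<inter> sphere V (dist V J)"
      using L by (simp only: second_intersection_def) simp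
    then have "dist U L = dist U J" "dist V L = dist V J" by simp_all
    then have LU: "(L - J) \<bullet> (L + J - 2 * U) = 0" and LV: "(L - J) \<bullet> (L + J - 2 * V) = 0"
      by (simp_all only: dist_eq_iff_chord)
    have "(L - J) \<bullet> d = ((L - J) \<bullet> (L + J - 2 * U) - (L - J) \<bullet> (L + J - 2 * V)) / 2"
      by (simp add: d_def inner_complex_def algebra_simps)
    then have Ld: "(L - J) \<bullet> d = 0"
      by (simp add: LU LV)
    have "J = m" using that by (simp add: R_def)
    then have LJ: "(L + J - 2 * U) - (2 * s) *\<^sub>R d = L - J"
      by (simp add: m_def scaleR_conv_of_real algebra_simps)
    have "(L - J) \<bullet> ((L + J - 2 * U) - (2 * s) *\<^sub>R d) = 0"
      by (simp only: inner_diff_right[of _ _ "(2 * s) *\<^sub>R d"] inner_scaleR_right LU Ld mult_zero_right diff_self)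
    then have "(L - J) \<bullet> (L - J) = 0"
      by (simp only: LJ)
    then show ?thesis by simp
  qed
  ultimately show ?thesis
    using refl by auto
qed

section \<open>Altitude chords and the centres of the circles through \<open>J\<close>\<close>

text \<open>
  The centre of a circle projects to the midpoint of any chord. The factor \<open>A - H\<close> plays the part
  of the direction of the altitude; it vanishes if \<open>H = A\<close>, as for a right angle at \<open>A\<close>. When
  \<open>X = H\<close>, the chord has no direction of its own and the tangency has to be exploited.
\<close>

lemma second_intersection_altitude_midpoint:
  assumes BC: "B \<noteq> C"
    and X: "second_intersection (sphere Q r) (altitude A B C) H X"
  shows "(X + H - 2 * Q) \<bullet> (A - H) = 0" and "(X - A) \<bullet> (C - B) = 0" and "(H - A) \<bullet> (C - B) = 0"
proof -
  have mem: "X \<in> sphere Q r" "H \<in> sphere Q r" "X \<in> altitude A B C" "H \<in> altitude A B C"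
    using X by (auto simp: second_intersection_def)
  show XA: "(X - A) \<bullet> (C - B) = 0" and HA: "(H - A) \<bullet> (C - B) = 0"
    using mem by (simp_all add: altitude_def orthogonal_def)
  show "(X + H - 2 * Q) \<bullet> (A - H) = 0"
  proof (cases "X = H")
    case False
    have "(A - H) \<bullet> (C - B) = 0" "(X - H) \<bullet> (C - B) = 0"
      using XA HA by (simp_all add: inner_diff_left)
    then obtain s where s: "A - H = s *\<^sub>R (X - H)"
      using common_perpendicular_parallel[of "A - H" "C - B" "X - H"] BC False by auto
    have "dist Q X = dist Q H" using mem by simp
    then have "(X - H) \<bullet> (X + H - 2 * Q) = 0"
      by (simp only: dist_eq_iff_chord)
    then show ?thesis
      by (simp add: s inner_commute)
  next
    case True
    show ?thesis
    proof (cases "A = H")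
      case False
      \<comment> \<open>\<open>P\<close> is the reflection of \<open>H\<close> in the projection of \<open>Q\<close> to the altitude, hence a common point.\<close>
      define u where "u = A - H"
      define s where "s = 2 * ((H - Q) \<bullet> u) / (u \<bullet> u)"
      define P where "P = H - s *\<^sub>R u"
      have uu: "u \<bullet> u \<noteq> 0" using False by (simp add: u_def)
      have u: "u \<bullet> (C - B) = 0"
        using HA by (simp add: u_def inner_diff_left)
      have PH: "P - H = (- s) *\<^sub>R u" "P + H - 2 * Q = 2 *\<^sub>R (H - Q) - s *\<^sub>R u"
        by (simp_all add: P_def scaleR_conv_of_real algebra_simps)
      have "u \<bullet> (2 *\<^sub>R (H - Q) - s *\<^sub>R u) = 0"
        using uu by (simp add: s_def inner_diff_right inner_commute)
      then have "dist Q P = dist Q H"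
        unfolding dist_eq_iff_chord PH by simp
      then have "P \<in> sphere Q r" using mem by simp
      moreover have "P - A = (H - A) - s *\<^sub>R u"
        by (simp add: P_def)
      then have "(P - A) \<bullet> (C - B) = 0"
        using HA u by (simp add: inner_diff_left)
      then have "P \<in> altitude A B C"
        by (simp add: altitude_def orthogonal_def)
      ultimately have "P \<in> sphere Q r \<inter> altitude A B C" by blast
      then have "P \<in> {H, X}"
        using X by (simp only: second_intersection_def)
      then have "P = H"
        using True by simp
      then have "s = 0"
        using uu by (auto simp: P_def)
      then have "(H - Q) \<bullet> u = 0"
        using uu by (simp add: s_def)
      moreover have "(X + H - 2 * Q) \<bullet> (A - H) = 2 * ((H - Q) \<bullet> u)"
        using True by (simp add: u_def inner_complex_def algebra_simps)
      ultimately show ?thesis by simp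
    qed simp
  qed
qed

text \<open>
  The image \<open>f A\<close> is equidistant from \<open>A\<close> and \<open>J\<close> because \<open>1 - 2 * k\<close> is purely imaginary. For the same
  reason \<open>A + X - 2 * f A\<close> differs from \<open>H + X - 2 * f H\<close> only by a vector perpendicular to the
  altitude, so \<open>f A\<close> projects to the midpoint of \<open>A X\<close> just as \<open>f H\<close> projects to the midpoint of
  \<open>H X\<close>. If \<open>A = H\<close>, the circle is the given one, with centre \<open>f H\<close>.
\<close>

lemma circumcircle_vertex_second_intersection:
  assumes f: "\<And>z w. f z - f w = k * (z - w)" and k: "Re k = 1 / 2" and fJ: "f J = J"
    and BC: "B \<noteq> C"
    and X: "second_intersection (sphere (f H) (dist (f H) J)) (altitude A B C) H X"
    and nc: "\<not> collinear {A, J, X}"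
  shows "circumcircle A J X = sphere (f A) (dist (f A) J)"
proof -
  note X' = second_intersection_altitude_midpoint[OF BC X]
  have fA: "f A = J + k * (A - J)"
    using f[of A J] fJ by (simp add: algebra_simps)
  have "A + J - 2 * f A = (1 - 2 * k) * (A - J)"
    unfolding fA by (simp add: algebra_simps)
  then have "(A - J) \<bullet> (A + J - 2 * f A) = 0"
    using k by (simp only: inner_mult_self) simp
  then have "dist (f A) A = dist (f A) J"
    by (simp only: dist_eq_iff_chord)
  moreover have "dist (f A) X = dist (f A) J"
  proof (cases "A = H")
    case True
    then show ?thesis
      using X by (auto simp: second_intersection_def)
  next
    case False
    have "(A - H) \<bullet> (C - B) = 0"
      using X'(3) by (simp add: inner_diff_left)
    then obtain s where s: "X - A = s *\<^sub>R (A - H)"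
      using common_perpendicular_parallel[of "X - A" "C - B" "A - H"] X'(2) BC False by auto
    have fAH: "f A = f H + k * (A - H)"
      using f[of A H] by (simp add: algebra_simps)
    have split: "X + A - 2 * f A = (X + H - 2 * f H) + (1 - 2 * k) * (A - H)"
      unfolding fAH by (simp add: algebra_simps)
    have mid: "(A - H) \<bullet> (X + H - 2 * f H) = 0"
      using X'(1) by (simp only: inner_commute)
    have imag: "(A - H) \<bullet> ((1 - 2 * k) * (A - H)) = 0"
      using k by (simp only: inner_mult_self) simp
    have "(A - H) \<bullet> (X + A - 2 * f A) = 0"
      by (simp only: split inner_add_right[of _ _ "(1 - 2 * k) * (A - H)"] imag mid add_0_right)
    then have "dist (f A) X = dist (f A) A"
      unfolding dist_eq_iff_chord s by simp
    then show ?thesis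
      using \<open>dist (f A) A = dist (f A) J\<close> by simp
  qed
  ultimately show ?thesis
    using nc by (intro circumcircle_eqI) auto
qed

section \<open>Steiner's theorem on the orthocentre and the doubled Simson line\<close>

text \<open>
  The hypothesis says that \<open>(x - P) / (R - P)\<close> is its own conjugate. Points on a circle centred at
  the origin have conjugates that are rational in them, so it becomes an identity of rational functions.
\<close>

lemma in_affine_hull_pairI:
  fixes x P R :: complex
  assumes "P \<noteq> R" and "cnj (x - P) * (R - P) = (x - P) * cnj (R - P)"
  shows "x \<in> affine hull {P, R}"
proof -
  define q where "q = (x - P) / (R - P)"
  have "cnj q = q"
    using assms by (simp add: q_def frac_eq_eq mult.commute)
  then have q: "q = of_real (Re q)"
    by (metis Reals_cnj_iff of_real_Re)
  have "x = P + q * (R - P)"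
    using assms(1) by (simp add: q_def)
  also have "\<dots> = P + Re q *\<^sub>R (R - P)"
    using q by (metis scaleR_conv_of_real)
  finally show ?thesis
    by (auto simp: in_line_iff)
qed

lemma cnj_on_circle:
  assumes "norm z = r" "r > 0"
  shows "z \<noteq> 0" and "cnj z = of_real (r\<^sup>2) / z"
proof -
  show "z \<noteq> 0" using assms by auto
  then show "cnj z = of_real (r\<^sup>2) / z"
    using complex_norm_square[of z] assms by (simp add: field_simps)
qed

text \<open>
  With \<open>c\<close> as origin and \<open>r\<close> as unit of length this is the familiar formula \<open>u + v - u * v * cnj j\<close>
  for the reflection in the chord of two unit complex numbers; writing \<open>1 / j\<close> for \<open>cnj j\<close> makes it
  independent of the radius.
\<close>

lemma reflection_in_chord:
  fixes U V J c :: complex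
  assumes r: "r > 0" "dist c U = r" "dist c V = r" "dist c J = r" and UV: "U \<noteq> V"
  shows "reflection_in (line_through U V) J = U + V - c - (U - c) * (V - c) / (J - c)"
proof (rule reflection_in_eqI)
  define u v j where "u = U - c" and "v = V - c" and "j = J - c"
  have "norm u = r" "norm v = r" "norm j = r"
    using r by (simp_all add: u_def v_def j_def dist_norm norm_minus_commute)
  note nz = cnj_on_circle(1)[OF this(1) r(1)] cnj_on_circle(1)[OF this(2) r(1)] cnj_on_circle(1)[OF this(3) r(1)]
    and cn = cnj_on_circle(2)[OF this(1) r(1)] cnj_on_circle(2)[OF this(2) r(1)] cnj_on_circle(2)[OF this(3) r(1)]
  define R where "R = U + V - c - (U - c) * (V - c) / (J - c)"
  have R: "R - J = u + v - j - u * v / j" "(J + R) / 2 - U = (j + v - u - u * v / j) / 2" "V - U = v - u"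
    by (simp_all add: R_def u_def v_def j_def field_simps)
  have "(J + R) / 2 \<in> affine hull {U, V}"
  proof (rule in_affine_hull_pairI[OF UV])
    show "cnj ((J + R) / 2 - U) * (V - U) = ((J + R) / 2 - U) * cnj (V - U)"
      unfolding R using nz r(1) by (simp add: cn field_simps)
  qed
  then show "(J + (U + V - c - (U - c) * (V - c) / (J - c))) / 2 \<in> line_through U V"
    by (simp add: R_def line_through_def)
  have "(R - J) * cnj (V - U) + cnj (R - J) * (V - U) = 0"
    unfolding R using nz r(1) by (simp add: cn field_simps)
  moreover have "(R - J) * cnj (V - U) + cnj (R - J) * (V - U) = of_real (2 * ((R - J) \<bullet> (V - U)))"
    by (simp add: complex_eq_iff inner_complex_def algebra_simps)
  ultimately have "(R - J) \<bullet> (V - U) = 0"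
    by (simp only: of_real_eq_0_iff)
  then show "((U + V - c - (U - c) * (V - c) / (J - c)) - J) \<bullet> (V - U) = 0"
    by (simp add: R_def)
qed

text \<open>
  Steiner's theorem with the circumcentre as origin. The differences \<open>M - L\<close>, \<open>N - L\<close> and
  \<open>a + b + c - L\<close> factorise, and conjugation multiplies each of them by the same unimodular number
  \<open>r\<^sup>2 * j / (a * b * c)\<close>, which makes their ratios real.
\<close>

lemma steiner_reflections:
  fixes a b c j :: complex
  assumes r: "r > 0" "norm a = r" "norm b = r" "norm c = r" "norm j = r"
    and ne: "a \<noteq> b" "c \<noteq> j"
  defines "L \<equiv> b + c - b * c / j" and "M \<equiv> c + a - c * a / j" and "N \<equiv> a + b - a * b / j"
  shows "L \<noteq> M" and "N \<in> affine hull {L, M}" and "a + b + c \<in> affine hull {L, M}"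
proof -
  note nz = r(2-5)[THEN cnj_on_circle(1), OF r(1)] and cn = r(2-5)[THEN cnj_on_circle(2), OF r(1)]
  have D: "M - L = (a - b) * (j - c) / j"
    using nz by (simp add: L_def M_def field_simps)
  then have "M - L \<noteq> 0"
    using nz ne by simp
  then show LM: "L \<noteq> M" by auto
  have NL: "N - L = (a - c) * (j - b) / j" and HL: "a + b + c - L = (a * j + b * c) / j"
    using nz by (simp_all add: L_def N_def field_simps)
  show "N \<in> affine hull {L, M}"
  proof (rule in_affine_hull_pairI[OF LM])
    show "cnj (N - L) * (M - L) = (N - L) * cnj (M - L)"
      unfolding D NL using nz r(1) by (simp add: cn field_simps)
  qed
  show "a + b + c \<in> affine hull {L, M}"
  proof (rule in_affine_hull_pairI[OF LM])
    show "cnj (a + b + c - L) * (M - L) = (a + b + c - L) * cnj (M - L)"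
      unfolding D HL using nz r(1) by (simp add: cn field_simps)
  qed
qed

text \<open>
  Translation to the circumcentre. Since \<open>M - L\<close> has the factors \<open>A - B\<close> and \<open>J - C\<close>, the two
  reflections \<open>L\<close> and \<open>M\<close> are distinct and already span the Double Wallace-Simson line.
\<close>

lemma steiner_theorem:
  fixes A B C J c :: complex
  assumes nc: "\<not> collinear {A, B, C}"
    and r: "r > 0" "dist c A = r" "dist c B = r" "dist c C = r" "dist c J = r"
    and J: "J \<noteq> C"
  defines "L \<equiv> reflection_in (line_through B C) J"
    and "M \<equiv> reflection_in (line_through C A) J"
    and "N \<equiv> reflection_in (line_through A B) J"
  shows "L \<noteq> M" and "N \<in> affine hull {L, M}" and "orthocentre A B C \<in> affine hull {L, M}"
proof -
  have ne: "A \<noteq> B" "B \<noteq> C" "C \<noteq> A"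
    using nc by (auto simp: insert_commute)
  define L' M' N' where "L' = (B - c) + (C - c) - (B - c) * (C - c) / (J - c)"
    and "M' = (C - c) + (A - c) - (C - c) * (A - c) / (J - c)"
    and "N' = (A - c) + (B - c) - (A - c) * (B - c) / (J - c)"
  have eq: "L = c + L'" "M = c + M'" "N = c + N'"
    using reflection_in_chord[OF r(1,3,4,5) ne(2)] reflection_in_chord[OF r(1,4,2,5) ne(3)]
      reflection_in_chord[OF r(1,2,3,5) ne(1)]
    by (simp_all add: L_def M_def N_def L'_def M'_def N'_def)
  have H: "orthocentre A B C = c + ((A - c) + (B - c) + (C - c))"
    using orthocentre_eq[OF nc r(2,3,4)] by simp
  have hull: "c + x \<in> affine hull {c + y, c + z} \<longleftrightarrow> x \<in> affine hull {y, z}" for x y z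
    by (simp add: in_line_iff add.assoc)
  have "norm (A - c) = r" "norm (B - c) = r" "norm (C - c) = r" "norm (J - c) = r"
    using r by (simp_all add: dist_norm norm_minus_commute)
  note S = steiner_reflections[OF r(1) this, folded L'_def M'_def N'_def]
  show "L \<noteq> M" "N \<in> affine hull {L, M}" "orthocentre A B C \<in> affine hull {L, M}"
    unfolding eq H hull using S ne J by simp_all
qed

text \<open>
  Conjugating \<open>j = a + b + c\<close> gives \<open>1 / j = 1 / a + 1 / b + 1 / c\<close>. In terms of the
  elementary symmetric functions of \<open>a\<close>, \<open>b\<close>, \<open>c\<close> this means \<open>e\<^sub>1 = j\<close> and \<open>e\<^sub>3 = j * e\<^sub>2\<close>, so \<open>j\<close> is a
  root of the cubic \<open>t ^ 3 - e\<^sub>1 * t\<^sup>2 + e\<^sub>2 * t - e\<^sub>3\<close> with roots \<open>a\<close>, \<open>b\<close>, \<open>c\<close>.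
\<close>

lemma orthocentre_on_circumcircle_is_vertex:
  fixes a b c j :: complex
  assumes r: "r > 0" "norm a = r" "norm b = r" "norm c = r" "norm j = r"
    and j: "j = a + b + c"
  shows "j = a \<or> j = b \<or> j = c"
proof -
  note nz = r(2-5)[THEN cnj_on_circle(1), OF r(1)] and cn = r(2-5)[THEN cnj_on_circle(2), OF r(1)]
  have "cnj j = cnj a + cnj b + cnj c"
    by (simp add: j)
  then have "of_real (r\<^sup>2) * (1 / j) = of_real (r\<^sup>2) * (1 / a + 1 / b + 1 / c :: complex)"
    unfolding cn by (simp add: algebra_simps)
  then have "1 / j = 1 / a + 1 / b + 1 / c"
    using r(1) by (metis mult_left_cancel of_real_eq_0_iff order_less_irrefl zero_eq_power2)
  then have "a * b * c = j * (b * c + a * c + a * b)"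
    using nz by (simp add: field_simps)
  then have "(j - a) * (j - b) * (j - c) = 0"
    unfolding j by algebra
  then show ?thesis by simp
qed

section \<open>The line \<open>L M N\<close> for a point of the circumcircle\<close>

theorem theorem4p3:
  fixes A B C H J Q X Y Z L M N A\<^sub>0 B\<^sub>0 C\<^sub>0 :: complex
    and S :: "complex set" and f :: "complex \<Rightarrow> complex"
  assumes "\<not> collinear {A, B, C}"
    and "H = orthocentre A B C"
    and "J \<in> circumcircle A B C" and "J \<noteq> A" and "J \<noteq> B" and "J \<noteq> C"
    and "Q \<in> perpendicular_bisector J H"
    and "S = sphere Q (dist Q J)"
    and "second_intersection S (altitude A B C) H X"
    and "second_intersection S (altitude B C A) H Y"
    and "second_intersection S (altitude C A B) H Z"
    and "\<not> collinear {A, J, X}" and "\<not> collinear {B, J, Y}" and "\<not> collinear {C, J, Z}"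
    and "second_intersection (circumcircle B J Y) (circumcircle C J Z) J L"
    and "second_intersection (circumcircle C J Z) (circumcircle A J X) J M"
    and "second_intersection (circumcircle A J X) (circumcircle B J Y) J N"
    and "direct_similarity f" and "f J = J" and "f H = Q"
    and "A\<^sub>0 = f A" and "B\<^sub>0 = f B" and "C\<^sub>0 = f C"
  shows "L = reflection_in (line_through B\<^sub>0 C\<^sub>0) J
       \<and> M = reflection_in (line_through C\<^sub>0 A\<^sub>0) J
       \<and> N = reflection_in (line_through A\<^sub>0 B\<^sub>0) J
       \<and> \<not> collinear {A\<^sub>0, B\<^sub>0, C\<^sub>0}
       \<and> J \<in> circumcircle A\<^sub>0 B\<^sub>0 C\<^sub>0
       \<and> aff_dim {L, M, N} = 1
       \<and> affine hull {L, M, N} = double_wallace_simson_line A\<^sub>0 B\<^sub>0 C\<^sub>0 J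
       \<and> Q \<in> affine hull {L, M, N}"
proof -
  note nc = assms(1)
  obtain c r where r: "r > 0" "dist c A = r" "dist c B = r" "dist c C = r"
    using circumcentre_exists[OF nc] by blast
  have J: "dist c J = r"
    using assms(3) circumcircle_eqI[OF nc r(2-4)] by simp
  have ne: "A \<noteq> B" "B \<noteq> C" "C \<noteq> A"
    using nc by (auto simp: insert_commute)
  have H: "H = A + B + C - 2 * c"
    using assms(2) orthocentre_eq[OF nc r(2-4)] by simp
  have HJ: "J \<noteq> H"
  proof
    assume "J = H"
    then have "J - c = (A - c) + (B - c) + (C - c)"
      using H by simp
    moreover have "norm (A - c) = r" "norm (B - c) = r" "norm (C - c) = r" "norm (J - c) = r"
      using r J by (simp_all add: dist_norm norm_minus_commute)
    ultimately have "J - c = A - c \<or> J - c = B - c \<or> J - c = C - c"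
      using orthocentre_on_circumcircle_is_vertex[OF r(1)] by blast
    then show False
      using assms(4-6) by simp
  qed
  obtain k where k: "k \<noteq> 0" "\<And>z w. f z - f w = k * (z - w)"
    using direct_similarity_affine[OF assms(18)] by blast
  have fJ: "f J = J" and fH: "f H = Q" by (fact assms)+
  \<comment> \<open>In the coordinate in which \<open>J\<close> is \<open>0\<close> and \<open>H\<close> is \<open>1\<close>, the bisector is the line of real part one half
    and \<open>Q\<close> is \<open>k\<close>.\<close>
  have Re_k: "Re k = 1 / 2"
  proof -
    have perp: "(H - J) \<bullet> (Q - midpoint J H) = 0"
      using assms(7) by (simp add: perpendicular_bisector_def orthogonal_def inner_commute)
    have Q: "Q = J + k * (H - J)"
      using k(2)[of H J] fJ fH by (simp add: algebra_simps)
    have "Q - midpoint J H = (k - 1 / 2) * (H - J)"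
      unfolding Q by (simp add: midpoint_def scaleR_conv_of_real field_simps)
    then have "Re (k - 1 / 2) * ((H - J) \<bullet> (H - J)) = 0"
      using perp by (simp only: inner_mult_self)
    then show ?thesis
      using HJ by simp
  qed
  have S: "S = sphere (f H) (dist (f H) J)"
    using assms(8) fH by simp
  note circ = circumcircle_vertex_second_intersection[OF k(2) Re_k fJ]
  have circA: "circumcircle A J X = sphere A\<^sub>0 (dist A\<^sub>0 J)"
    using circ[OF ne(2) assms(9)[unfolded S] assms(12)] assms(21) by simp
  have circB: "circumcircle B J Y = sphere B\<^sub>0 (dist B\<^sub>0 J)"
    using circ[OF ne(3) assms(10)[unfolded S] assms(13)] assms(22) by simp
  have circC: "circumcircle C J Z = sphere C\<^sub>0 (dist C\<^sub>0 J)"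
    using circ[OF ne(1) assms(11)[unfolded S] assms(14)] assms(23) by simp
  have nc0: "\<not> collinear {A\<^sub>0, B\<^sub>0, C\<^sub>0}"
    using nc k by (simp add: collinear_iff_signed_area2 assms(21-23) signed_area2_similarity[of f k])
  then have ne0: "A\<^sub>0 \<noteq> B\<^sub>0" "B\<^sub>0 \<noteq> C\<^sub>0" "C\<^sub>0 \<noteq> A\<^sub>0"
    by (auto simp: insert_commute)
  have L: "L = reflection_in (line_through B\<^sub>0 C\<^sub>0) J"
    using second_intersection_circles_reflection[OF ne0(2)] assms(15) by (simp add: circB circC)
  have M: "M = reflection_in (line_through C\<^sub>0 A\<^sub>0) J"
    using second_intersection_circles_reflection[OF ne0(3)] assms(16) by (simp add: circC circA)
  have N: "N = reflection_in (line_through A\<^sub>0 B\<^sub>0) J"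
    using second_intersection_circles_reflection[OF ne0(1)] assms(17) by (simp add: circA circB)
  have "dist (f c) (f z) = norm k * dist c z" for z
    by (simp add: dist_norm k(2) norm_mult)
  then have r0: "dist (f c) A\<^sub>0 = norm k * r" "dist (f c) B\<^sub>0 = norm k * r"
      "dist (f c) C\<^sub>0 = norm k * r" "dist (f c) J = norm k * r"
    using r J fJ assms(21-23) by metis+
  have pos: "norm k * r > 0" using k(1) r(1) by simp
  \<comment> \<open>Affine maps respect the combination \<open>A + B + C - 2 * c\<close>, whose coefficients add up to one.\<close>
  have "A\<^sub>0 + B\<^sub>0 + C\<^sub>0 - 2 * f c = Q"
  proof -
    have fz: "f z = J + k * (z - J)" for z
      using k(2)[of z J] fJ by (simp add: algebra_simps)
    show ?thesis
      unfolding assms(21-23) fH[symmetric] H fz by (simp add: algebra_simps)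
  qed
  then have Q: "orthocentre A\<^sub>0 B\<^sub>0 C\<^sub>0 = Q"
    using orthocentre_eq[OF nc0 r0(1-3)] by simp
  have "J \<noteq> C\<^sub>0"
    using k(1) k(2)[of C J] fJ assms(6,23) by auto
  note steiner = steiner_theorem[OF nc0 pos r0 this, folded L M N, unfolded Q]
  have "{L, M, N} = insert N {L, M}" by auto
  then have hull: "affine hull {L, M, N} = affine hull {L, M}"
    using steiner(2) by (simp add: hull_redundant)
  then have "aff_dim {L, M, N} = aff_dim {L, M}"
    by (metis aff_dim_affine_hull)
  then have "aff_dim {L, M, N} = 1"
    using steiner(1) by simp
  moreover have "J \<in> circumcircle A\<^sub>0 B\<^sub>0 C\<^sub>0"
    using circumcircle_eqI[OF nc0 r0(1-3)] r0(4) by simp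
  moreover have "affine hull {L, M, N} = double_wallace_simson_line A\<^sub>0 B\<^sub>0 C\<^sub>0 J"
    by (simp only: double_wallace_simson_line_def L M N)
  moreover have "Q \<in> affine hull {L, M, N}"
    using steiner(3) hull by simp
  ultimately show ?thesis
    using L M N nc0 by blast
qed

end
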